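(* Suppose $\sigma=\{z_1,z_2,z_3\}$ is a set of three non-collinear points in $\mathbb{C}$ and that $f:\sigma\to\mathbb{C}$. Then $$\mathrm{var}(f,\sigma)=\frac12\sum_{1\le i<j\le 3}|f(z_i)-f(z_j)|.$$
   Context: Identify $\mathbb{C}$ with $\mathbb{R}^2$. A list $S=[x_0,x_1,\dots,x_n]$ ($n\ge 0$) is a finite ordered list of points of the plane; repetitions are allowed. For a line $\ell$ in the plane and $n\ge 1$, the segment $\overline{x_j\,x_{j+1}}$ ($0\le j<n$) is a crossing segment of $S$ on $\ell$ if one of the following holds: (1) $x_j$ and $x_{j+1}$ lie on strictly opposite sides of $\ell$; (2) $j=0$ and $x_0\in\ell$; (3) $x_j\notin\ell$ and $x_{j+1}\in\ell$. Let $\mathrm{vf}(S,\ell)$ be the number of crossing segments of $S$ on $\ell$ (counted by index $j$); for $n=0$ put $\mathrm{vf}([x_0],\ell)=1$ if $x_0\in\ell$ and $0$ otherwise. The variation factor is $\mathrm{vf}(S)=\max_\ell \mathrm{vf}(S,\ell)$, the maximum over all lines in the plane. For a nonempty compact set $\sigma$ in the plane, $f:\sigma\to\mathbb{C}$ and a list $S=[x_0,\dots,x_n]$ of elements of $\sigma$, put $\mathrm{cvar}(f,S)=\sum_{i=1}^n|f(x_i)-f(x_{i-1})|$ (equal to $0$ if $n=0$), and $\mathrm{var}(f,\sigma)=\sup_S \mathrm{cvar}(f,S)/\mathrm{vf}(S)\in[0,\infty]$, the supremum over all finite ordered lists of elements of $\sigma$. *)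

theory Defs
  imports "HOL-Analysis.Analysis"
begin

text \<open>The plane is the type \<^typ>\<open>complex\<close> with its Euclidean structure over the reals:
  \<open>affine\<close>, \<open>aff_dim\<close> and \<open>\<bullet>\<close> are the real notions.\<close>

definition is_line :: "complex set \<Rightarrow> bool" where
  "is_line l \<longleftrightarrow> affine l \<and> aff_dim l = 1"

text \<open>The two points lie in the two different open half-planes bounded by \<open>l\<close>. The relation is
  symmetric in \<open>x\<close> and \<open>y\<close>, since \<open>(a, b)\<close> may be replaced by \<open>(- a, - b)\<close>.\<close>

definition strictly_opposite :: "complex set \<Rightarrow> complex \<Rightarrow> complex \<Rightarrow> bool" where
  "strictly_opposite l x y \<longleftrightarrow>
     (\<exists>a b. a \<noteq> 0 \<and> l = {z. a \<bullet> z = b} \<and> a \<bullet> x < b \<and> b < a \<bullet> y)"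

text \<open>A list \<open>[x\<^sub>0, \<dots>, x\<^sub>n]\<close> has length \<open>n + 1\<close>, so its segments are indexed by the \<open>j\<close> with
  \<open>Suc j < length S\<close>. Only nonempty lists are meaningful below.\<close>

definition crossing_segment :: "complex list \<Rightarrow> complex set \<Rightarrow> nat \<Rightarrow> bool" where
  "crossing_segment S l j \<longleftrightarrow>
     strictly_opposite l (S ! j) (S ! Suc j) \<or>
     (j = 0 \<and> S ! 0 \<in> l) \<or>
     (S ! j \<notin> l \<and> S ! Suc j \<in> l)"

definition vf_line :: "complex list \<Rightarrow> complex set \<Rightarrow> nat" where
  "vf_line S l =
     (if length S = 1 then (if S ! 0 \<in> l then 1 else 0)
      else card {j. Suc j < length S \<and> crossing_segment S l j})"

definition vf :: "complex list \<Rightarrow> nat" where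
  "vf S = Max {vf_line S l | l. is_line l}"

definition cvar :: "(complex \<Rightarrow> complex) \<Rightarrow> complex list \<Rightarrow> real" where
  "cvar f S = (\<Sum>i\<in>{1..<length S}. cmod (f (S ! i) - f (S ! (i - 1))))"

text \<open>The supremum is taken in \<open>[0, \<infinity>]\<close>; the quotient is a genuine one by \<open>vf_ge_1\<close> below.
  Only the values of \<open>f\<close> on \<open>\<sigma>\<close> matter.\<close>

definition variation :: "(complex \<Rightarrow> complex) \<Rightarrow> complex set \<Rightarrow> ennreal" where
  "variation f \<sigma> = (SUP S\<in>{S. S \<noteq> [] \<and> set S \<subseteq> \<sigma>}. ennreal (cvar f S / real (vf S)))"

text \<open>The maximum defining \<open>vf\<close> is over a finite nonempty set, and is positive.\<close>

lemma vf_line_le: "vf_line S l \<le> max 1 (length S)"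
proof -
  have "card {j. Suc j < length S \<and> crossing_segment S l j} \<le> card {..<length S}"
    by (rule card_mono) auto
  then show ?thesis by (auto simp: vf_line_def max_def)
qed

lemma finite_vf_line: "finite {vf_line S l | l. is_line l}"
  by (rule finite_subset[of _ "{..max 1 (length S)}"]) (use vf_line_le in auto)

lemma ex_line_through: "\<exists>l. is_line l \<and> x \<in> l"
proof (intro exI conjI)
  show "is_line (affine hull {x, x + 1})"
    unfolding is_line_def by (simp add: aff_dim_2)
  show "x \<in> affine hull {x, x + 1}"
    by (rule hull_inc) simp
qed

lemma vf_line_le_vf: "is_line l \<Longrightarrow> vf_line S l \<le> vf S"
  unfolding vf_def by (rule Max_ge[OF finite_vf_line]) auto

lemma vf_ge_1:
  assumes "S \<noteq> []"
  shows "1 \<le> vf S"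
proof -
  obtain l where l: "is_line l" "S ! 0 \<in> l"
    using ex_line_through by blast
  have "1 \<le> vf_line S l"
  proof (cases "length S = 1")
    case True
    then show ?thesis using l by (simp add: vf_line_def)
  next
    case False
    let ?J = "{j. Suc j < length S \<and> crossing_segment S l j}"
    have "finite ?J" by (rule finite_subset[of _ "{..<length S}"]) auto
    moreover have "Suc 0 < length S"
      using False assms by (cases S) auto
    with l have "0 \<in> ?J" by (simp add: crossing_segment_def)
    ultimately have "card ?J \<noteq> 0" by auto
    then show ?thesis using False by (simp add: vf_line_def)
  qed
  then show ?thesis using vf_line_le_vf[OF l(1)] le_trans by blast
qed

end

theory Submission
  imports Defs
begin

text \<open>Upper bound: if a list makes \<open>p\<close>, \<open>q\<close>, \<open>r\<close> steps along the sides \<open>z\<^sub>2z\<^sub>3\<close>, \<open>z\<^sub>1z\<^sub>3\<close>,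
  \<open>z\<^sub>1z\<^sub>2\<close>, then a line cutting off one vertex shows that the variation factor is at least each of
  \<open>q + r\<close>, \<open>p + r\<close>, \<open>p + q\<close>, and the triangle inequality between the three values of \<open>f\<close>
  gives the estimate. Lower bound: running \<open>n\<close> times around the triangle gives the sum \<open>n\<close> times, while a line meets at most two sides in each round; only the initial
  point can contribute one more crossing, so the variation factor is at most \<open>2 n + 1\<close>.
  Let \<open>n\<close> tend to infinity.\<close>

section \<open>Half-planes of a line and the vertices of a triangle\<close>

lemma strictly_opposite_commute: "strictly_opposite l x y \<longleftrightarrow> strictly_opposite l y x"
proof -
  have "strictly_opposite l y x" if "strictly_opposite l x y" for x y
  proof -
    obtain a b where "a \<noteq> 0" "l = {z. a \<bullet> z = b}" "a \<bullet> x < b" "b < a \<bullet> y"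
      using \<open>strictly_opposite l x y\<close> unfolding strictly_opposite_def by blast
    then show ?thesis
      unfolding strictly_opposite_def by (intro exI[of _ "- a"] exI[of _ "- b"]) auto
  qed
  then show ?thesis by blast
qed

lemma strictly_opposite_not_in:
  "strictly_opposite l x y \<Longrightarrow> x \<notin> l \<and> y \<notin> l"
  unfolding strictly_opposite_def by auto

text \<open>The segment from \<open>x\<close> to \<open>y\<close> meets \<open>l\<close>, which does not depend on the equation of \<open>l\<close>.\<close>

lemma strictly_opposite_hyperplane:
  assumes "strictly_opposite {z. c \<bullet> z = d} x y"
  shows "(c \<bullet> x < d \<and> d < c \<bullet> y) \<or> (c \<bullet> y < d \<and> d < c \<bullet> x)"
proof -
  obtain a b where ab: "{z. c \<bullet> z = d} = {z. a \<bullet> z = b}" "a \<bullet> x < b" "b < a \<bullet> y"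
    using assms unfolding strictly_opposite_def by blast
  define t where "t = (b - a \<bullet> x) / (a \<bullet> y - a \<bullet> x)"
  have t: "0 < t" "t < 1"
    using ab unfolding t_def by (auto simp: field_simps)
  have "a \<bullet> (x + t *\<^sub>R (y - x)) = b"
    using ab(2,3) unfolding t_def by (simp add: inner_add_right inner_diff_right)
  then have "c \<bullet> (x + t *\<^sub>R (y - x)) = d"
    using ab(1) by blast
  then have eq: "(1 - t) * (c \<bullet> x - d) = t * (d - c \<bullet> y)"
    by (simp add: inner_add_right inner_diff_right algebra_simps)
  have "c \<bullet> x \<noteq> d"
    using ab by auto
  then consider "c \<bullet> x < d" | "d < c \<bullet> x" by linarith
  then show ?thesis
  proof cases
    case 1
    then have "t * (d - c \<bullet> y) < 0"
      unfolding eq[symmetric] using t by (simp add: mult_pos_neg)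
    then show ?thesis using 1 t by (simp add: mult_less_0_iff)
  next
    case 2
    then have "0 < t * (d - c \<bullet> y)"
      unfolding eq[symmetric] using t by simp
    then show ?thesis using 2 t by (simp add: zero_less_mult_iff)
  qed
qed

text \<open>Pigeonhole: one fixed equation of \<open>l\<close> has two open half-planes, so two of
  three points off \<open>l\<close> share one of them.\<close>

lemma not_strictly_opposite_triangle:
  "\<not> (strictly_opposite l x y \<and> strictly_opposite l y z \<and> strictly_opposite l z x)"
proof
  assume opp: "strictly_opposite l x y \<and> strictly_opposite l y z \<and> strictly_opposite l z x"
  then obtain a b where "l = {z. a \<bullet> z = b}"
    unfolding strictly_opposite_def by blast
  then show False
    using opp strictly_opposite_hyperplane[of a b x y] strictly_opposite_hyperplane[of a b y z]
      strictly_opposite_hyperplane[of a b z x] by auto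
qed

text \<open>Non-collinearity keeps \<open>x\<close> off the segment from \<open>y\<close> to
  \<open>z\<close>, which is compact and convex, so a hyperplane strictly separates the two; in the
  plane a hyperplane is a line.\<close>

lemma ex_line_separating_vertex:
  assumes "\<not> collinear {x, y, z}"
  shows "\<exists>l. is_line l \<and> strictly_opposite l x y \<and> strictly_opposite l x z"
proof -
  have "x \<notin> convex hull {y, z}"
  proof
    assume "x \<in> convex hull {y, z}"
    then have "between (y, z) x"
      by (simp add: between_mem_convex_hull)
    then have "collinear {y, x, z}"
      by (rule between_imp_collinear)
    then show False
      using assms by (simp add: insert_commute)
  qed
  then obtain a b where ab: "a \<bullet> x < b" "\<And>w. w \<in> convex hull {y, z} \<Longrightarrow> b < a \<bullet> w"
    using separating_hyperplane_closed_point[of "convex hull {y, z}" x]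
    by (auto simp: compact_imp_closed finite_imp_compact_convex_hull)
  have yz: "b < a \<bullet> y" "b < a \<bullet> z"
    using ab(2) by (simp_all add: hull_inc)
  have "a \<noteq> 0"
    using ab(1) yz(1) by auto
  then have "is_line {w. a \<bullet> w = b}"
    unfolding is_line_def by (simp add: affine_hyperplane)
  then show ?thesis
    using \<open>a \<noteq> 0\<close> ab(1) yz unfolding strictly_opposite_def by blast
qed

section \<open>Upper bound: counting steps along the sides\<close>

text \<open>The pair is unordered, so both directions of travel are counted; neither
  \<open>cvar\<close> nor a strict crossing depends on the direction.\<close>

definition steps :: "'a list \<Rightarrow> 'a \<Rightarrow> 'a \<Rightarrow> nat set" where
  "steps S x y = {j. Suc j < length S \<and> {S ! j, S ! Suc j} = {x, y}}"

lemma finite_steps: "finite (steps S x y)"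
  by (rule finite_subset[of _ "{..<length S}"]) (auto simp: steps_def)

lemma steps_commute: "steps S x y = steps S y x"
  by (simp add: steps_def insert_commute)

text \<open>The line cutting \<open>x\<close> off from \<open>y\<close> and \<open>z\<close> is
  crossed by every step along either side at \<open>x\<close>, and no step runs along both. The
  length hypothesis selects the counting branch of \<open>vf_line\<close>.\<close>

lemma card_steps_le_vf:
  assumes "length S \<noteq> 1" and nc: "\<not> collinear {x, y, z}"
  shows "card (steps S x y) + card (steps S x z) \<le> vf S"
proof -
  obtain l where l: "is_line l" "strictly_opposite l x y" "strictly_opposite l x z"
    using ex_line_separating_vertex[OF nc] by blast
  let ?J = "{j. Suc j < length S \<and> crossing_segment S l j}"
  have "y \<noteq> z"
    using nc collinear_2[of x y] by auto
  then have "steps S x y \<inter> steps S x z = {}"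
    by (auto simp: steps_def doubleton_eq_iff)
  then have "card (steps S x y) + card (steps S x z) = card (steps S x y \<union> steps S x z)"
    by (simp add: card_Un_disjoint finite_steps)
  also have "\<dots> \<le> card ?J"
  proof (rule card_mono)
    show "finite ?J"
      by (rule finite_subset[of _ "{..<length S}"]) auto
    show "steps S x y \<union> steps S x z \<subseteq> ?J"
      using l(2,3) strictly_opposite_commute[of l]
      by (auto simp: steps_def crossing_segment_def doubleton_eq_iff)
  qed
  also have "\<dots> = vf_line S l"
    using assms(1) by (simp add: vf_line_def)
  also have "\<dots> \<le> vf S"
    using l(1) by (rule vf_line_le_vf)
  finally show ?thesis .
qed

lemma cvar_eq_sum_Suc:
  "cvar f S = (\<Sum>j<length S - 1. cmod (f (S ! Suc j) - f (S ! j)))"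
  unfolding cvar_def
  by (rule sum.reindex_bij_witness[of _ Suc "\<lambda>i. i - 1"]) auto

text \<open>A step between equal points contributes 0; any other step joins exactly one of the three
  pairs, as the points are distinct.\<close>

lemma cvar_eq_steps:
  assumes S: "set S \<subseteq> {x, y, z}" and "distinct [x, y, z]"
  shows "cvar f S = card (steps S y z) * cmod (f y - f z)
    + card (steps S x z) * cmod (f x - f z) + card (steps S x y) * cmod (f x - f y)"
proof -
  let ?J = "{..<length S - 1}"
  have weight: "(\<Sum>j\<in>?J. if {S ! j, S ! Suc j} = {u, v} then c else 0) = card (steps S u v) * c"
    for u v and c :: real
  proof -
    have "{j \<in> ?J. {S ! j, S ! Suc j} = {u, v}} = steps S u v"
      by (auto simp: steps_def)
    then show ?thesis
      by (simp add: sum.inter_filter[symmetric])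
  qed
  have "cvar f S = (\<Sum>j\<in>?J.
      (if {S ! j, S ! Suc j} = {y, z} then cmod (f y - f z) else 0)
      + (if {S ! j, S ! Suc j} = {x, z} then cmod (f x - f z) else 0)
      + (if {S ! j, S ! Suc j} = {x, y} then cmod (f x - f y) else 0))"
    unfolding cvar_eq_sum_Suc
  proof (rule sum.cong)
    fix j assume "j \<in> ?J"
    then have "S ! j \<in> {x, y, z}" "S ! Suc j \<in> {x, y, z}"
      using S nth_mem by (metis Suc_lessD Suc_lessI lessThan_iff less_diff_conv plus_1_eq_Suc
          add.commute subsetD)+
    then show "cmod (f (S ! Suc j) - f (S ! j)) =
      (if {S ! j, S ! Suc j} = {y, z} then cmod (f y - f z) else 0)
      + (if {S ! j, S ! Suc j} = {x, z} then cmod (f x - f z) else 0)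
      + (if {S ! j, S ! Suc j} = {x, y} then cmod (f x - f y) else 0)"
      using assms(2) by (auto simp: doubleton_eq_iff norm_minus_commute)
  qed simp
  then show ?thesis
    by (simp only: sum.distrib weight)
qed

text \<open>In the ordering \<open>p \<ge> q \<ge> r\<close>, with \<open>v = p + q\<close>, twice the right-hand side minus twice the
  left-hand side is at least \<open>(p - q) * (B + C - A)\<close>.\<close>

lemma weighted_sum_le_half:
  fixes A B C p q r v :: real
  assumes tri: "A \<le> B + C" "B \<le> A + C" "C \<le> A + B"
    and v: "q + r \<le> v" "p + r \<le> v" "p + q \<le> v"
  shows "p * A + q * B + r * C \<le> v * (1 / 2 * (A + B + C))"
proof -
  have pos: "0 \<le> A" "0 \<le> B" "0 \<le> C"
    using tri by linarith+
  have *: "p * A + q * B + r * C \<le> v * (1 / 2 * (A + B + C))"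
    if "A \<le> B + C" "0 \<le> A" "0 \<le> B" "0 \<le> C" "p + q \<le> v" "q \<le> p" "r \<le> q"
    for A B C p q r :: real
  proof -
    have "0 \<le> (p - q) * (B + C - A)" "0 \<le> (q - r) * C"
      using that by simp_all
    then have "2 * (p * A + q * B + r * C) \<le> (p + q) * (A + B + C)"
      by (simp add: algebra_simps)
    also have "\<dots> \<le> v * (A + B + C)"
      using that by (intro mult_right_mono) auto
    finally show ?thesis by simp
  qed
  consider "q \<le> p" "r \<le> q" | "r \<le> p" "q \<le> r" | "p \<le> q" "r \<le> p" | "r \<le> q" "p \<le> r"
    | "p \<le> r" "q \<le> p" | "q \<le> r" "p \<le> q"
    by linarith
  then show ?thesis
  proof cases
    case 1
    then show ?thesis using *[of A B C p q r] tri v pos by (simp add: algebra_simps)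
  next
    case 2
    then show ?thesis using *[of A C B p r q] tri v pos by (simp add: algebra_simps)
  next
    case 3
    then show ?thesis using *[of B A C q p r] tri v pos by (simp add: algebra_simps)
  next
    case 4
    then show ?thesis using *[of B C A q r p] tri v pos by (simp add: algebra_simps)
  next
    case 5
    then show ?thesis using *[of C A B r p q] tri v pos by (simp add: algebra_simps)
  next
    case 6
    then show ?thesis using *[of C B A r q p] tri v pos by (simp add: algebra_simps)
  qed
qed

lemma cvar_div_vf_le:
  assumes S: "S \<noteq> []" "set S \<subseteq> {x, y, z}" and nc: "\<not> collinear {x, y, z}"
  shows "cvar f S / real (vf S)
    \<le> 1 / 2 * (cmod (f x - f y) + cmod (f x - f z) + cmod (f y - f z))"
proof (cases "length S = 1")
  case True
  then show ?thesis by (simp add: cvar_def)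
next
  case False
  have dist: "distinct [x, y, z]"
    using nc by (auto simp: insert_commute)
  have nc': "\<not> collinear {y, x, z}" "\<not> collinear {z, x, y}"
    using nc by (simp_all add: insert_commute)
  \<comment> \<open>The factor \<open>vf S\<close> plays the role of \<open>v\<close> in
    \<open>weighted_sum_le_half\<close>; each of its three bounds comes from the line cutting off
    one vertex.\<close>
  have "cvar f S \<le> vf S * (1 / 2 * (cmod (f y - f z) + cmod (f x - f z) + cmod (f x - f y)))"
    unfolding cvar_eq_steps[OF S(2) dist]
  proof (rule weighted_sum_le_half)
    show "cmod (f y - f z) \<le> cmod (f x - f z) + cmod (f x - f y)"
      using norm_triangle_ineq4[of "f x - f z" "f x - f y"] by simp
    show "cmod (f x - f z) \<le> cmod (f y - f z) + cmod (f x - f y)"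
      using norm_triangle_ineq[of "f y - f z" "f x - f y"] by simp
    show "cmod (f x - f y) \<le> cmod (f y - f z) + cmod (f x - f z)"
      using norm_triangle_ineq4[of "f x - f z" "f y - f z"] by simp
  qed (use card_steps_le_vf[OF False nc] card_steps_le_vf[OF False nc'(1)]
      card_steps_le_vf[OF False nc'(2)] in \<open>simp_all add: steps_commute flip: of_nat_add\<close>)
  then show ?thesis
    using vf_ge_1[OF S(1)] by (simp add: field_simps)
qed

section \<open>Lower bound: running around the triangle\<close>

text \<open>The final entry returns to \<open>x\<close> and closes the last round, so there are
  exactly \<open>3 * n\<close> steps.\<close>

definition cycle_list :: "'a \<Rightarrow> 'a \<Rightarrow> 'a \<Rightarrow> nat \<Rightarrow> 'a list" where
  "cycle_list x y z n = map (\<lambda>i. [x, y, z] ! (i mod 3)) [0..<3 * n + 1]"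

lemma length_cycle_list [simp]: "length (cycle_list x y z n) = 3 * n + 1"
  by (simp add: cycle_list_def)

lemma nth_cycle_list: "i \<le> 3 * n \<Longrightarrow> cycle_list x y z n ! i = [x, y, z] ! (i mod 3)"
  by (simp add: cycle_list_def del: upt_Suc)

lemma set_cycle_list: "set (cycle_list x y z n) \<subseteq> {x, y, z}"
proof -
  have "[x, y, z] ! (i mod 3) \<in> set [x, y, z]" for i
    by (rule nth_mem) simp
  then show ?thesis by (auto simp: cycle_list_def simp del: upt_Suc)
qed

lemma sum_lessThan_mult_3:
  fixes g :: "nat \<Rightarrow> 'a::comm_monoid_add"
  shows "(\<Sum>j<3 * n. g j) = (\<Sum>m<n. g (3 * m) + g (3 * m + 1) + g (3 * m + 2))"
  by (induction n) (simp_all add: eval_nat_numeral ac_simps)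

lemma nth_cycle:
  "[x, y, z] ! (3 * m mod 3) = x" "[x, y, z] ! ((3 * m + 1) mod 3) = y"
  "[x, y, z] ! ((3 * m + 2) mod 3) = z" "[x, y, z] ! ((3 * m + 3) mod 3) = x"
proof -
  have "(3 * m + 1) mod 3 = 1" "(3 * m + 2) mod 3 = 2"
    by presburger+
  then show "[x, y, z] ! (3 * m mod 3) = x" "[x, y, z] ! ((3 * m + 1) mod 3) = y"
    "[x, y, z] ! ((3 * m + 2) mod 3) = z" "[x, y, z] ! ((3 * m + 3) mod 3) = x"
    by simp_all
qed

text \<open>The summand \<open>g\<close> is arbitrary because the sum is used twice: with real
  distances for \<open>cvar\<close> and with 0-1 indicators of crossings for
  \<open>vf\<close>.\<close>

lemma sum_cycle:
  fixes g :: "'a \<Rightarrow> 'a \<Rightarrow> 'b::semiring_1"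
  shows "(\<Sum>j<3 * n. g ([x, y, z] ! (j mod 3)) ([x, y, z] ! (Suc j mod 3)))
    = of_nat n * (g x y + g y z + g z x)"
proof -
  have Suc_eqs: "Suc (3 * m) = 3 * m + 1" "Suc (3 * m + 1) = 3 * m + 2" "Suc (3 * m + 2) = 3 * m + 3"
    for m :: nat by simp_all
  show ?thesis
    unfolding sum_lessThan_mult_3 Suc_eqs nth_cycle by simp
qed

lemma cvar_cycle_list:
  "cvar f (cycle_list x y z n) = n * (cmod (f x - f y) + cmod (f x - f z) + cmod (f y - f z))"
proof -
  have "cvar f (cycle_list x y z n)
    = (\<Sum>j<3 * n. cmod (f ([x, y, z] ! (Suc j mod 3)) - f ([x, y, z] ! (j mod 3))))"
    unfolding cvar_eq_sum_Suc by (rule sum.cong) (simp_all add: nth_cycle_list)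
  also have "\<dots> = n * (cmod (f y - f x) + cmod (f z - f y) + cmod (f x - f z))"
    by (rule sum_cycle)
  finally show ?thesis
    by (simp add: norm_minus_commute algebra_simps)
qed

lemma vf_cycle_list_le:
  assumes "n > 0"
  shows "vf (cycle_list x y z n) \<le> 2 * n + 1"
proof -
  let ?S = "cycle_list x y z n"
  have "vf_line ?S l \<le> 2 * n + 1" for l
  proof -
    \<comment> \<open>Clauses (1) and (3) of a crossing: they depend only on the two ends of a step
      and not on its index.\<close>
    define P where "P u v \<longleftrightarrow> strictly_opposite l u v \<or> (u \<notin> l \<and> v \<in> l)" for u v
    let ?Q = "\<lambda>j. P ([x, y, z] ! (j mod 3)) ([x, y, z] ! (Suc j mod 3))"
    \<comment> \<open>Since \<open>P u v\<close> forces \<open>u\<close> off \<open>l\<close>, all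
      three together would put every vertex off \<open>l\<close>, making all three crossings
      strict.\<close>
    have triangle: "\<not> (P x y \<and> P y z \<and> P z x)"
      using not_strictly_opposite_triangle[of l x y z] strictly_opposite_not_in[of l]
      unfolding P_def by blast
    \<comment> \<open>Index 0 is added for clause (2), a start on \<open>l\<close>; this is the
      source of the 1 in \<open>2 * n + 1\<close>.\<close>
    have "{j. Suc j < length ?S \<and> crossing_segment ?S l j} \<subseteq> insert 0 {j \<in> {..<3 * n}. ?Q j}"
      by (auto simp: crossing_segment_def P_def nth_cycle_list)
    then have "card {j. Suc j < length ?S \<and> crossing_segment ?S l j}
        \<le> card (insert 0 {j \<in> {..<3 * n}. ?Q j})"
      by (rule card_mono[rotated]) simp
    also have "\<dots> \<le> Suc (card {j \<in> {..<3 * n}. ?Q j})"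
      by (rule card_insert_le_m1) simp_all
    also have "card {j \<in> {..<3 * n}. ?Q j} = (\<Sum>j<3 * n. of_bool (?Q j))"
      by (simp add: Int_def)
    also have "\<dots> = n * (of_bool (P x y) + of_bool (P y z) + of_bool (P z x))"
      using sum_cycle[where g = "\<lambda>u v. of_bool (P u v) :: nat"] by (simp only: of_nat_id)
    also have "\<dots> \<le> n * 2"
      using triangle by (intro mult_left_mono) auto
    finally show ?thesis
      using assms by (simp add: vf_line_def)
  qed
  then show ?thesis
    unfolding vf_def using ex_line_through
    by (subst Max_le_iff[OF finite_vf_line]) auto
qed

theorem theorem2p25:
  fixes z1 z2 z3 :: complex and \<sigma> :: "complex set" and f :: "complex \<Rightarrow> complex"
  assumes "\<sigma> = {z1, z2, z3}"
    and "\<not> collinear {z1, z2, z3}"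
  shows "variation f \<sigma> =
    ennreal (1 / 2 * (cmod (f z1 - f z2) + cmod (f z1 - f z3) + cmod (f z2 - f z3)))"
proof (rule antisym)
  let ?T = "cmod (f z1 - f z2) + cmod (f z1 - f z3) + cmod (f z2 - f z3)"
  show "variation f \<sigma> \<le> ennreal (1 / 2 * ?T)"
    unfolding variation_def using assms
    by (intro SUP_least ennreal_leI cvar_div_vf_le) auto
  \<comment> \<open>With \<open>n = Suc m\<close> rounds the quotient is at least
    \<open>n * ?T / (2 * n + 1)\<close>; dividing through by \<open>n\<close> leaves the null
    sequence \<open>inverse (real (Suc m))\<close> as the only varying term.\<close>
  have "ennreal (?T / (2 + inverse (real (Suc m)))) \<le> variation f \<sigma>" for m
  proof -
    let ?S = "cycle_list z1 z2 z3 (Suc m)"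
    have ne: "?S \<noteq> []"
      by (metis length_cycle_list list.size(3) add_is_0 one_neq_zero)
    have "?T / (2 + inverse (real (Suc m))) = cvar f ?S / (2 * real (Suc m) + 1)"
      by (simp add: cvar_cycle_list field_simps del: of_nat_Suc)
    also have "\<dots> \<le> cvar f ?S / real (vf ?S)"
    proof (rule divide_left_mono)
      show "real (vf ?S) \<le> 2 * real (Suc m) + 1"
        using of_nat_mono[OF vf_cycle_list_le[of "Suc m" z1 z2 z3], where 'a = real] by simp
      show "0 \<le> cvar f ?S"
        by (simp add: cvar_def sum_nonneg)
      show "0 < (2 * real (Suc m) + 1) * real (vf ?S)"
        using vf_ge_1[OF ne] by simp
    qed
    finally have "ennreal (?T / (2 + inverse (real (Suc m)))) \<le> ennreal (cvar f ?S / real (vf ?S))"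
      by (rule ennreal_leI)
    also have "\<dots> \<le> variation f \<sigma>"
      unfolding variation_def using ne set_cycle_list assms(1) by (intro SUP_upper) simp
    finally show ?thesis .
  qed
  moreover have "(\<lambda>m. ?T / (2 + inverse (real (Suc m)))) \<longlonglongrightarrow> ?T / (2 + 0)"
    by (intro tendsto_divide tendsto_add tendsto_const LIMSEQ_inverse_real_of_nat) simp
  then have "(\<lambda>m. ennreal (?T / (2 + inverse (real (Suc m))))) \<longlonglongrightarrow> ennreal (1 / 2 * ?T)"
    using tendsto_ennrealI by fastforce
  ultimately show "ennreal (1 / 2 * ?T) \<le> variation f \<sigma>"
    using LIMSEQ_le_const2 by blast
qed

end
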